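(* If $G$ is a connected $(P_2+2P_1)$-free graph, then every vertex of maximum degree in $G$ is a Gallai vertex.
   Context: All graphs are finite and simple. $P_n$ is the path on $n$ vertices, $G+H$ denotes the disjoint union of graphs $G$ and $H$, $kG$ denotes the disjoint union of $k$ copies of $G$, and a graph is $F$-free if it has no induced subgraph isomorphic to $F$. A vertex $v$ of a graph $G$ is a Gallai vertex if every longest path in $G$ contains $v$. *)

theory Defs
  imports "Graph_Theory.Graph_Theory"
begin

text \<open>
  Finite simple graphs are the locale \<^locale>\<open>graph\<close>: finite, loop-free, symmetric digraphs
  without parallel arcs. An undirected edge is a pair of opposite arcs, so the out-degree
  of a vertex is its degree in the undirected sense.
\<close>

subsection \<open>Concrete graphs and disjoint unions\<close>

definition path_graph :: "nat \<Rightarrow> nat pair_pre_digraph" where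
  "path_graph n =
    \<lparr> pverts = {..<n}, parcs = {(i, j). i < n \<and> j < n \<and> (j = Suc i \<or> i = Suc j)} \<rparr>"

definition disjoint_union ::
  "'a pair_pre_digraph \<Rightarrow> 'b pair_pre_digraph \<Rightarrow> ('a + 'b) pair_pre_digraph" where
  "disjoint_union G H =
    \<lparr> pverts = pverts G <+> pverts H,
      parcs = {(Inl u, Inl v) | u v. (u, v) \<in> parcs G} \<union> {(Inr u, Inr v) | u v. (u, v) \<in> parcs H} \<rparr>"

definition copies :: "nat \<Rightarrow> 'a pair_pre_digraph \<Rightarrow> (nat \<times> 'a) pair_pre_digraph" where
  "copies k G =
    \<lparr> pverts = {..<k} \<times> pverts G,
      parcs = {((i, u), (i, v)) | i u v. i < k \<and> (u, v) \<in> parcs G} \<rparr>"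

lemma pair_graph_path_graph: "pair_graph (path_graph n)"
proof -
  have "finite (parcs (path_graph n))"
    by (rule finite_subset[of _ "{..<n} \<times> {..<n}"]) (auto simp: path_graph_def)
  then show ?thesis
    by unfold_locales (auto simp: path_graph_def symmetric_def intro!: symI)
qed

lemma pair_graph_disjoint_union:
  assumes "pair_graph G" "pair_graph H"
  shows "pair_graph (disjoint_union G H)"
proof -
  interpret G: pair_graph G by fact
  interpret H: pair_graph H by fact
  have symG: "sym (parcs G)" and symH: "sym (parcs H)"
    using G.pair_sym_arcs H.pair_sym_arcs by (simp_all add: symmetric_def)
  have "finite (parcs (disjoint_union G H))"
    by (rule finite_subset[of _ "(pverts G <+> pverts H) \<times> (pverts G <+> pverts H)"])
      (auto simp: disjoint_union_def dest: G.wellformed' H.wellformed')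
  then show ?thesis
    by unfold_locales
      (auto simp: disjoint_union_def symmetric_def intro!: symI
        dest: G.wellformed' H.wellformed' G.pair_no_loops H.pair_no_loops
          symD[OF symG] symD[OF symH])
qed

lemma pair_graph_copies:
  assumes "pair_graph G"
  shows "pair_graph (copies k G)"
proof -
  interpret G: pair_graph G by fact
  have symG: "sym (parcs G)"
    using G.pair_sym_arcs by (simp add: symmetric_def)
  have "finite (parcs (copies k G))"
    by (rule finite_subset[of _ "({..<k} \<times> pverts G) \<times> ({..<k} \<times> pverts G)"])
      (auto simp: copies_def dest: G.wellformed')
  then show ?thesis
    by unfold_locales
      (auto simp: copies_def symmetric_def intro!: symI
        dest: G.wellformed' G.pair_no_loops symD[OF symG])
qed

subsection \<open>Forbidden induced subgraphs\<close>

definition induced_free :: "('c, 'd) pre_digraph \<Rightarrow> ('a, 'b) pre_digraph \<Rightarrow> bool" where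
  "induced_free F G \<longleftrightarrow> \<not> (\<exists>H. induced_subgraph H G \<and> digraph_iso H F)"

subsection \<open>Maximum degree, longest paths, Gallai vertices\<close>

definition max_degree :: "('a, 'b) pre_digraph \<Rightarrow> nat" where
  "max_degree G = Max (out_degree G ` verts G)"

definition longest_path :: "('a, 'b) pre_digraph \<Rightarrow> 'a vwalk \<Rightarrow> bool" where
  "longest_path G p \<longleftrightarrow> vpath p G \<and> (\<forall>q. vpath q G \<longrightarrow> vwalk_length q \<le> vwalk_length p)"

definition gallai_vertex :: "('a, 'b) pre_digraph \<Rightarrow> 'a \<Rightarrow> bool" where
  "gallai_vertex G v \<longleftrightarrow> v \<in> verts G \<and> (\<forall>p. longest_path G p \<longrightarrow> v \<in> set p)"

end

theory Submission
  imports Defs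
begin

text \<open>
  Let \<open>p\<close> be a longest path that misses a vertex \<open>v\<close> of degree \<open>d\<close>. The goal is a neighbour of \<open>v\<close>
  of degree at least \<open>d + 1\<close>. In a \<open>(P\<^sub>2 + 2P\<^sub>1)\<close>-free graph, any two distinct vertices that are both
  nonadjacent to both ends of some edge are adjacent (\<open>common_nonneighbours_adjacent\<close>), and this is
  used twice.

  First, all neighbours of \<open>v\<close> lie on \<open>p\<close> (\<open>longest_path_contains_neighbours\<close>). A neighbour \<open>w\<close> off
  \<open>p\<close> would give an edge whose ends are both nonadjacent to the two ends of \<open>p\<close>, as otherwise \<open>p\<close>
  could be prolonged. So the ends of \<open>p\<close> would coincide or be adjacent. But then \<open>p\<close> could be
  opened at any of its vertices, and by connectedness at one with a neighbour off \<open>p\<close>, which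
  again yields a longer path (\<open>longest_path_ends_nonadjacent\<close>).

  Second, let \<open>S\<close> consist of the first vertex of \<open>p\<close> and the successors on \<open>p\<close> of the neighbours
  of \<open>v\<close>. Since the last vertex of \<open>p\<close> is not a neighbour of \<open>v\<close>, this set has \<open>d + 1\<close> elements. The
  usual exchange argument shows that \<open>S\<close> is independent and contains no neighbour of \<open>v\<close>
  (\<open>longest_path_independent_successors\<close>). Now take any edge \<open>v x\<close>. All but at most one vertex of
  \<open>S\<close> must be adjacent to \<open>x\<close>, and so is \<open>v\<close> itself, so \<open>x\<close> has degree at least \<open>d + 1\<close>
  (\<open>neighbour_degree_ge_card_independent\<close>). Hence \<open>v\<close> does not have maximum degree.
\<close>

(* Its arrow would make every adjacency statement ambiguous. *)
unbundle no funcset_syntax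

context graph
begin

section \<open>Neighbours and connectedness\<close>

lemma out_degree_eq_card_neighbours: "out_degree G v = card {w. v \<rightarrow> w}"
proof -
  have "bij_betw (head G) (out_arcs G v) {w. v \<rightarrow> w}"
    unfolding bij_betw_def inj_on_def
    by (auto simp: arcs_ends_conv arc_to_ends_def intro: no_multi_arcs)
  then show ?thesis
    unfolding out_degree_def by (rule bij_betw_same_card)
qed

lemma finite_neighbours: "finite {w. v \<rightarrow> w}"
  by (rule finite_subset[OF _ finite_verts]) auto

lemma no_self_neighbour: "\<not> v \<rightarrow> v"
  using no_loops by (auto simp: arcs_ends_conv)

lemma connected_leaving_edge:
  assumes "connected G" "u \<in> S" "S \<subseteq> verts G" "w \<in> verts G" "w \<notin> S"
  obtains x y where "x \<in> S" "y \<notin> S" "x \<rightarrow> y"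
proof -
  have "u \<rightarrow>\<^sup>* w"
    using assms(1,2,3,4) reachable_mk_symmetric_eq[OF sym_arcs]
    by (auto simp: connected_def strongly_connected_def)
  then have "u \<in> S \<Longrightarrow> \<exists>x\<in>S. \<exists>y. y \<notin> S \<and> x \<rightarrow> y"
    using \<open>w \<notin> S\<close> by (induct rule: converse_reachable_induct) blast+
  with \<open>u \<in> S\<close> show thesis
    using that by blast
qed

section \<open>Graphs without an induced \<open>P\<^sub>2 + 2P\<^sub>1\<close>\<close>

text \<open>
  Otherwise \<open>a, b, c, d\<close> induce the forbidden graph, with \<open>a b\<close> as the copy of \<open>P\<^sub>2\<close>. By symmetry
  the hypotheses already keep \<open>c\<close> and \<open>d\<close> apart from \<open>a\<close> and \<open>b\<close>.
\<close>
lemma common_nonneighbours_adjacent: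
  assumes free: "induced_free (with_proj (disjoint_union (path_graph 2) (copies 2 (path_graph 1)))) G"
    and "a \<rightarrow> b" "c \<in> verts G" "d \<in> verts G" "c \<noteq> d"
    and "\<not> a \<rightarrow> c" "\<not> b \<rightarrow> c" "\<not> a \<rightarrow> d" "\<not> b \<rightarrow> d"
  shows "c \<rightarrow> d"
proof (rule ccontr)
  assume "\<not> c \<rightarrow> d"
  have "b \<rightarrow> a" using \<open>a \<rightarrow> b\<close> graph_symmetric by blast
  have distinct: "a \<noteq> b" "a \<noteq> c" "b \<noteq> c" "a \<noteq> d" "b \<noteq> d"
    using assms \<open>b \<rightarrow> a\<close> no_self_neighbour by blast+
  let ?F = "with_proj (disjoint_union (path_graph 2) (copies 2 (path_graph 1)))"
  let ?H = "G \<restriction> {a, b, c, d}"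
  define f :: "'a \<Rightarrow> nat + nat \<times> nat" where
    "f x = (if x = a then Inl 0 else if x = b then Inl 1
            else if x = c then Inr (0, 0) else Inr (1, 0))" for x
  have f: "f a = Inl 0" "f b = Inl 1" "f c = Inr (0, 0)" "f d = Inr (1, 0)"
    using distinct \<open>c \<noteq> d\<close> by (auto simp: f_def)
  define iso where "iso = \<lparr> iso_verts = f, iso_arcs = (\<lambda>e. (f (tail G e), f (head G e))),
    iso_head = snd, iso_tail = fst \<rparr>"
  have sub: "{a, b, c, d} \<subseteq> verts G"
    using assms by auto
  then have induced: "induced_subgraph ?H G"
    by (rule induced_induce)
  have arcs: "arc_to_ends G ` arcs ?H = {(a, b), (b, a)}"
  proof -
    have "arc_to_ends G ` arcs ?H = arcs_ends G \<inter> {a, b, c, d} \<times> {a, b, c, d}"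
      by (auto simp: arcs_ends_def arc_to_ends_def)
    moreover have "\<not> c \<rightarrow> a" "\<not> c \<rightarrow> b" "\<not> d \<rightarrow> a" "\<not> d \<rightarrow> b" "\<not> d \<rightarrow> c"
      using assms \<open>\<not> c \<rightarrow> d\<close> graph_symmetric by blast+
    moreover have "\<not> u \<rightarrow> u" for u
      by (rule no_self_neighbour)
    ultimately show ?thesis
      using assms(2,6-9) \<open>b \<rightarrow> a\<close> \<open>\<not> c \<rightarrow> d\<close> by auto
  qed
  have inj: "inj_on f {a, b, c, d}"
    using f by (auto simp: inj_on_def)
  have "pre_digraph.digraph_isomorphism ?H iso"
  proof -
    interpret H: wf_digraph ?H
      by (rule wellformed_induce_subgraph)
    have "inj_on (\<lambda>e. (f (tail G e), f (head G e))) (arcs ?H)"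
    proof (rule inj_onI)
      fix e e'
      assume e: "e \<in> arcs ?H" "e' \<in> arcs ?H"
        and eq: "(f (tail G e), f (head G e)) = (f (tail G e'), f (head G e'))"
      from e eq have "tail G e = tail G e'" "head G e = head G e'"
        using inj_onD[OF inj] by auto
      with e show "e = e'"
        by (intro no_multi_arcs) (auto simp: arc_to_ends_def)
    qed
    with inj H.wf_digraph_axioms show ?thesis
      by (simp add: H.digraph_isomorphism_def iso_def)
  qed
  moreover have "?F = app_iso iso ?H"
  proof -
    have "verts ?F = {Inl 0, Inl 1, Inr (0, 0), Inr (1, 0)}"
      by (auto simp: disjoint_union_def path_graph_def copies_def numeral_2_eq_2 lessThan_Suc)
    moreover have "arcs ?F = {(Inl 0, Inl 1), (Inl 1, Inl 0)}"
      by (auto simp: disjoint_union_def path_graph_def copies_def less_2_cases_iff)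
    moreover have "arcs (app_iso iso ?H) = (\<lambda>(x, y). (f x, f y)) ` arc_to_ends G ` arcs ?H"
      by (simp add: iso_def image_image arc_to_ends_def)
    ultimately show ?thesis
      unfolding arcs using f by (intro pre_digraph.equality) (auto simp: iso_def)
  qed
  ultimately have "digraph_iso ?H ?F"
    by (auto simp: digraph_iso_def)
  with induced free show False
    by (auto simp: induced_free_def)
qed

text \<open>
  Two members of \<open>S\<close> missed by \<open>x\<close> would be nonadjacent vertices missed by both ends of the edge
  \<open>v x\<close>, so \<open>x\<close> misses at most one member of \<open>S\<close>. This loss is compensated by the neighbour \<open>v\<close> of
  \<open>x\<close>, which lies outside \<open>S\<close>.
\<close>
lemma neighbour_degree_ge_card_independent:
  assumes "induced_free (with_proj (disjoint_union (path_graph 2) (copies 2 (path_graph 1)))) G"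
    and "v \<rightarrow> x" "S \<subseteq> verts G" "\<And>s. s \<in> S \<Longrightarrow> \<not> v \<rightarrow> s" "v \<notin> S"
    and "\<And>s t. s \<in> S \<Longrightarrow> t \<in> S \<Longrightarrow> \<not> s \<rightarrow> t"
  shows "card S \<le> out_degree G x"
proof -
  let ?M = "{s \<in> S. \<not> x \<rightarrow> s}"
  have "finite S"
    using \<open>S \<subseteq> verts G\<close> finite_verts by (rule finite_subset)
  have "s = t" if "s \<in> ?M" "t \<in> ?M" for s t
    using common_nonneighbours_adjacent[OF assms(1,2), of s t] assms(3-6) that by blast
  then have "card ?M \<le> 1"
    using \<open>finite S\<close> by (auto simp: card_le_Suc0_iff_eq)
  moreover have "card S = card ?M + card {s \<in> S. x \<rightarrow> s}"
    using \<open>finite S\<close> by (subst card_Un_disjoint[symmetric]) (auto intro: arg_cong[where f = card])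
  moreover have "card (insert v {s \<in> S. x \<rightarrow> s}) \<le> out_degree G x"
    unfolding out_degree_eq_card_neighbours
    using \<open>v \<rightarrow> x\<close> graph_symmetric by (intro card_mono finite_neighbours) auto
  ultimately show ?thesis
    using \<open>finite S\<close> \<open>v \<notin> S\<close> by simp
qed

section \<open>Exchange arguments on longest paths\<close>

lemma vpath_iff_successively:
  "vpath p G \<longleftrightarrow> p \<noteq> [] \<and> set p \<subseteq> verts G \<and> distinct p \<and> successively (\<lambda>x y. x \<rightarrow> y) p"
proof -
  have "set (vwalk_arcs p) \<subseteq> arcs_ends G \<longleftrightarrow> successively (\<lambda>x y. x \<rightarrow> y) p"
    by (induct p rule: vwalk_arcs.induct) auto
  then show ?thesis
    by (auto simp: vpath_def vwalk_def)
qed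

text \<open>
  The exchange arguments below all rearrange the vertices of a longest path together with one new
  vertex; multisets reduce each of them to checking adjacency of consecutive vertices.
\<close>
lemma longest_path_no_extension:
  assumes "longest_path G p" "v \<in> verts G" "v \<notin> set p" "mset q = add_mset v (mset p)"
  shows "\<not> successively (\<lambda>x y. x \<rightarrow> y) q"
proof
  assume walk: "successively (\<lambda>x y. x \<rightarrow> y) q"
  have p: "p \<noteq> []" "set p \<subseteq> verts G" "distinct p"
    using assms(1) by (auto simp: longest_path_def vpath_iff_successively)
  have set: "set q = insert v (set p)"
    using arg_cong[OF assms(4), of set_mset] by simp
  have len: "length q = Suc (length p)"
    using arg_cong[OF assms(4), of size] by simp
  have "distinct q"
    using mset_eq_imp_distinct_iff[of q "v # p"] assms(3,4) p by simp
  then have "vpath q G"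
    using walk set p \<open>v \<in> verts G\<close> len by (auto simp: vpath_iff_successively)
  then have "vwalk_length q \<le> vwalk_length p"
    using assms(1) by (simp add: longest_path_def)
  with len p show False
    by (cases p) auto
qed

text \<open>
  Otherwise \<open>A, v, C\<close> is a longer path. An empty \<open>A\<close> or \<open>C\<close> covers attaching \<open>v\<close> to an end of the
  path.
\<close>
lemma longest_path_no_insertion:
  assumes "longest_path G (A @ C)" "v \<in> verts G" "v \<notin> set (A @ C)"
    and "A \<noteq> [] \<Longrightarrow> v \<rightarrow> last A" "C \<noteq> [] \<Longrightarrow> v \<rightarrow> hd C"
  shows False
proof -
  have "successively (\<lambda>x y. x \<rightarrow> y) (A @ C)"
    using assms(1) by (simp add: longest_path_def vpath_iff_successively)
  then have "successively (\<lambda>x y. x \<rightarrow> y) (A @ [v] @ C)"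
    using assms(4,5) graph_symmetric by (auto simp: successively_append_iff successively_Cons)
  with longest_path_no_extension[OF assms(1,2,3), of "A @ [v] @ C"] show False
    by simp
qed

text \<open>
  Otherwise \<open>A, v\<close>, then \<open>B\<close> reversed, then \<open>C\<close> is a longer path. With \<open>A\<close> empty this says that the
  first vertex of the path is nonadjacent to the successor of a neighbour of \<open>v\<close>; otherwise it
  says that the successors of two neighbours of \<open>v\<close> are nonadjacent.
\<close>
lemma longest_path_no_crossing:
  assumes "longest_path G p" "v \<in> verts G" "v \<notin> set p" "p = A @ B @ C"
    and "B \<noteq> []" "C \<noteq> []" "A \<noteq> [] \<Longrightarrow> v \<rightarrow> last A" "v \<rightarrow> last B"
  shows "\<not> hd B \<rightarrow> hd C"
proof
  assume cross: "hd B \<rightarrow> hd C"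
  have sym: "successively (\<lambda>x y. y \<rightarrow> x) B = successively (\<lambda>x y. x \<rightarrow> y) B"
    using graph_symmetric by (intro successively_cong) auto
  have "successively (\<lambda>x y. x \<rightarrow> y) (A @ B @ C)"
    using assms(1,4)
    by (simp add: longest_path_def vpath_iff_successively)
  then have "successively (\<lambda>x y. x \<rightarrow> y) (A @ [v] @ rev B @ C)"
    using assms(5-8) cross graph_symmetric
    by (auto simp: successively_append_iff successively_Cons sym hd_rev last_rev)
  with longest_path_no_extension[OF assms(1,2,3), of "A @ [v] @ rev B @ C"] assms(4) show False
    by simp
qed

text \<open>
  If the ends coincided (a one-vertex path) or were adjacent, every rotation of \<open>p\<close> would be a path
  too. Connectedness provides an edge from some \<open>x\<close> on \<open>p\<close> to some \<open>y\<close> off \<open>p\<close>, and the rotation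
  that starts at \<open>x\<close>, preceded by \<open>y\<close>, would be longer than \<open>p\<close>.
\<close>
lemma longest_path_ends_nonadjacent:
  assumes "connected G" "longest_path G p" "v \<in> verts G" "v \<notin> set p"
  shows "hd p \<noteq> last p" "\<not> hd p \<rightarrow> last p"
proof -
  have p: "p \<noteq> []" "set p \<subseteq> verts G" and walk: "successively (\<lambda>x y. x \<rightarrow> y) p"
    using assms(2) by (auto simp: longest_path_def vpath_iff_successively)
  obtain x y where "x \<in> set p" "y \<notin> set p" "x \<rightarrow> y"
    using connected_leaving_edge[OF assms(1) hd_in_set[OF p(1)] p(2) assms(3,4)] .
  then obtain A C where split: "p = A @ x # C"
    by (meson split_list)
  have "y \<rightarrow> x"
    using \<open>x \<rightarrow> y\<close> graph_symmetric by blast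
  have False if "hd p = last p \<or> hd p \<rightarrow> last p"
  proof -
    have "A = []" if "hd p = last p"
      using that split assms(2)
      by (cases A) (auto simp: longest_path_def vpath_def split: if_splits)
    moreover have "last p \<rightarrow> hd p" if "hd p \<rightarrow> last p"
      using that graph_symmetric by blast
    ultimately have "A \<noteq> [] \<Longrightarrow> last p \<rightarrow> hd p"
      using that by blast
    then have "A \<noteq> [] \<Longrightarrow> last (x # C) \<rightarrow> hd A"
      by (simp add: split)
    then have "successively (\<lambda>x y. x \<rightarrow> y) ((x # C) @ A)"
      using walk unfolding split successively_append_iff by blast
    then have "successively (\<lambda>x y. x \<rightarrow> y) (y # x # C @ A)"
      using \<open>y \<rightarrow> x\<close> by (simp add: successively_Cons)
    moreover have "\<not> successively (\<lambda>x y. x \<rightarrow> y) (y # x # C @ A)"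
      using \<open>x \<rightarrow> y\<close> \<open>y \<notin> set p\<close> split
      by (intro longest_path_no_extension[OF assms(2)]) auto
    ultimately show False by blast
  qed
  then show "hd p \<noteq> last p" "\<not> hd p \<rightarrow> last p"
    by blast+
qed

section \<open>Neighbours of a vertex missed by a longest path\<close>

text \<open>
  If \<open>w\<close> were off \<open>p\<close>, the edge \<open>v w\<close> and the two ends of \<open>p\<close> would induce \<open>P\<^sub>2 + 2P\<^sub>1\<close>.
\<close>
lemma longest_path_contains_neighbours:
  assumes "connected G"
    and "induced_free (with_proj (disjoint_union (path_graph 2) (copies 2 (path_graph 1)))) G"
    and p: "longest_path G p" and v: "v \<in> verts G" "v \<notin> set p" and "v \<rightarrow> w"
  shows "w \<in> set p"
proof (rule ccontr)
  assume w: "w \<notin> set p"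
  have "p \<noteq> []" "set p \<subseteq> verts G"
    using p by (auto simp: longest_path_def vpath_iff_successively)
  then have ends: "hd p \<in> verts G" "last p \<in> verts G"
    by auto
  have "\<not> u \<rightarrow> hd p" "\<not> u \<rightarrow> last p" if "u \<in> verts G" "u \<notin> set p" for u
    using longest_path_no_insertion[of "[]" p u] longest_path_no_insertion[of p "[]" u] p that
    by auto
  then have "hd p \<rightarrow> last p"
    using common_nonneighbours_adjacent[OF assms(2) \<open>v \<rightarrow> w\<close> ends]
      longest_path_ends_nonadjacent[OF assms(1) p v] v w \<open>v \<rightarrow> w\<close> by auto
  with longest_path_ends_nonadjacent[OF assms(1) p v] show False by blast
qed

text \<open>
  The set \<open>S\<close> consists of the first vertex of \<open>p\<close> and the successors on \<open>p\<close> of the neighbours of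
  \<open>v\<close>. Its positions are handled uniformly: a position \<open>a\<close> belongs to \<open>S\<close> exactly if the part of \<open>p\<close>
  before \<open>a\<close> is empty or ends in a neighbour of \<open>v\<close>, which is the condition on the first part in
  both exchange arguments.
\<close>
lemma longest_path_independent_successors:
  assumes p: "longest_path G p" and v: "v \<in> verts G" "v \<notin> set p"
    and neighbours: "{w. v \<rightarrow> w} \<subseteq> set p"
  obtains S where "S \<subseteq> set p" "card S = Suc (out_degree G v)"
    "\<And>s. s \<in> S \<Longrightarrow> \<not> v \<rightarrow> s" "\<And>s t. s \<in> S \<Longrightarrow> t \<in> S \<Longrightarrow> \<not> s \<rightarrow> t"
proof -
  let ?n = "length p"
  define I where "I = {i. i < ?n \<and> v \<rightarrow> p ! i}"
  define J where "J = insert 0 (Suc ` I)"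
  have "p \<noteq> []" and distinct: "distinct p"
    using p by (auto simp: longest_path_def vpath_iff_successively)
  have "\<not> v \<rightarrow> last p"
    using longest_path_no_insertion[of p "[]" v] p v by auto
  \<comment> \<open>Hence each neighbour of \<open>v\<close> on \<open>p\<close> has a successor.\<close>
  then have "i < ?n - 1" if "i \<in> I" for i
    using that \<open>p \<noteq> []\<close> by (cases "i = ?n - 1") (auto simp: I_def last_conv_nth)
  then have J_less: "a < ?n" if "a \<in> J" for a
    using that \<open>p \<noteq> []\<close> by (force simp: J_def)
  have J_pred: "v \<rightarrow> p ! (a - 1)" if "a \<in> J" "a \<noteq> 0" for a
    using that by (auto simp: J_def I_def)
  have subset: "nth p ` J \<subseteq> set p"
    using J_less by auto
  have "nth p ` I = {w. v \<rightarrow> w}"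
    using neighbours by (auto simp: I_def in_set_conv_nth subset_iff image_iff)
  moreover have inj: "inj_on (nth p) A" if "\<And>a. a \<in> A \<Longrightarrow> a < ?n" for A
    using that by (simp add: inj_on_def nth_eq_iff_index_eq[OF distinct])
  ultimately have "card I = out_degree G v"
    using card_image[OF inj[of I]] by (simp add: out_degree_eq_card_neighbours I_def)
  moreover have "card J = Suc (card I)"
    by (simp add: J_def I_def card_image)
  ultimately have card: "card (nth p ` J) = Suc (out_degree G v)"
    using card_image[OF inj[of J]] J_less by simp
  have last_take: "v \<rightarrow> last (take a p)" if "a \<in> J" "take a p \<noteq> []" for a
    using J_pred[OF that(1)] J_less[OF that(1)] that(2) by (auto simp: last_conv_nth min_def)
  have nonadjacent: "\<not> v \<rightarrow> s" if "s \<in> nth p ` J" for s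
  proof
    assume "v \<rightarrow> s"
    from that obtain a where a: "a \<in> J" "s = p ! a" by blast
    with \<open>v \<rightarrow> s\<close> show False
      using longest_path_no_insertion[of "take a p" "drop a p" v] last_take[OF a(1)]
        J_less[OF a(1)] p v by (auto simp: hd_drop_conv_nth)
  qed
  have ordered: "\<not> p ! a \<rightarrow> p ! b" if ab: "a \<in> J" "b \<in> J" "a < b" for a b
  proof -
    let ?B = "take (b - a) (drop a p)"
    have split: "p = take a p @ ?B @ drop b p"
      using \<open>a < b\<close> by (metis append_take_drop_id drop_drop le_add_diff_inverse2 less_imp_le)
    have "last ?B = p ! (b - 1)" "hd ?B = p ! a" "hd (drop b p) = p ! b" "?B \<noteq> []" "drop b p \<noteq> []"
      using J_less[OF ab(2)] \<open>a < b\<close>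
      by (auto simp: last_conv_nth hd_conv_nth min_def)
    then show ?thesis
      using longest_path_no_crossing[OF p v split]
        last_take[OF ab(1)] J_pred[OF ab(2)] \<open>a < b\<close> by auto
  qed
  have independent: "\<not> s \<rightarrow> t" if st: "s \<in> nth p ` J" "t \<in> nth p ` J" for s t
  proof -
    from st obtain a b where "a \<in> J" "b \<in> J" "s = p ! a" "t = p ! b" by blast
    then show ?thesis
      using ordered[of a b] ordered[of b a] no_self_neighbour graph_symmetric
      by (cases a b rule: linorder_cases) auto
  qed
  from subset card nonadjacent independent show thesis
    by (rule that)
qed

end

theorem proposition7:
  fixes G :: "('a, 'b) pre_digraph"
  assumes "graph G"
    and "connected G"
    and "induced_free (with_proj (disjoint_union (path_graph 2) (copies 2 (path_graph 1)))) G"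
  shows "\<forall>v \<in> verts G. out_degree G v = max_degree G \<longrightarrow> gallai_vertex G v"
proof (intro ballI impI)
  interpret graph G by fact
  fix v
  assume v: "v \<in> verts G" and max: "out_degree G v = max_degree G"
  have "v \<in> set p" if p: "longest_path G p" for p
  proof (rule ccontr)
    assume "v \<notin> set p"
    have path: "p \<noteq> []" "set p \<subseteq> verts G"
      using p by (auto simp: longest_path_def vpath_iff_successively)
    then have "hd p \<in> verts G" "hd p \<noteq> v"
      using \<open>v \<notin> set p\<close> by auto
    then obtain x where "v \<rightarrow>\<^bsub>G\<^esub> x"
      using connected_leaving_edge[OF assms(2), of v "{v}" "hd p"] v by auto
    have "{w. v \<rightarrow>\<^bsub>G\<^esub> w} \<subseteq> set p"
      using longest_path_contains_neighbours[OF assms(2,3) p v \<open>v \<notin> set p\<close>] by blast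
    then obtain S where S: "S \<subseteq> set p" "card S = Suc (out_degree G v)"
      "\<And>s. s \<in> S \<Longrightarrow> \<not> v \<rightarrow>\<^bsub>G\<^esub> s" "\<And>s t. s \<in> S \<Longrightarrow> t \<in> S \<Longrightarrow> \<not> s \<rightarrow>\<^bsub>G\<^esub> t"
      using longest_path_independent_successors[OF p v \<open>v \<notin> set p\<close>] by metis
    have "v \<notin> S" "S \<subseteq> verts G"
      using S(1) path \<open>v \<notin> set p\<close> by auto
    then have "Suc (out_degree G v) \<le> out_degree G x"
      using neighbour_degree_ge_card_independent[OF assms(3) \<open>v \<rightarrow>\<^bsub>G\<^esub> x\<close>, of S] S(2-4) by simp
    moreover have "out_degree G x \<le> max_degree G"
      unfolding max_degree_def using \<open>v \<rightarrow>\<^bsub>G\<^esub> x\<close> by (intro Max_ge) auto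
    ultimately show False
      using max by simp
  qed
  with v show "gallai_vertex G v"
    by (simp add: gallai_vertex_def)
qed

end
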